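(* For every constant $\alpha_0\ge 1$ there exist constants $c>0$ and $\varepsilon_0\in(0,1/4)$, depending only on $\alpha_0$, such that the following holds for all $\alpha\in[1,\alpha_0]$, all integers $a>2$, all integers $d\ge 2$, and all $\varepsilon\in(0,\varepsilon_0)$. Suppose there is an algorithm which, for every unknown quantum state $\rho$ on the $d$-dimensional Hilbert space, uses $n$ copies of $\rho$ to implement a single use of each of two quantum channels $\mathcal{E}_\rho$ and $\mathcal{E}_\rho^{\dagger}$ such that, for some $(\alpha,a,0)$-block encoding $U_\rho$ of $\rho$, $$\|\mathcal{E}_\rho-\mathcal{U}_\rho\|_\diamond\le\varepsilon,\qquad \|\mathcal{E}_\rho^{\dagger}-\mathcal{U}_\rho^{\dagger}\|_\diamond\le\varepsilon .$$ Then $n\ge c/\varepsilon$. That is, in the regime $\alpha=\Theta(1)$, any such algorithm requires $\Omega(1/\varepsilon)$ copies of $\rho$ in the worst case.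
   Context: Block encoding: for an operator $A$ on a $d$-dimensional Hilbert space $\mathcal{H}$, a positive integer $a$ and $\alpha>0$, a unitary $U$ on $(\mathbb{C}^2)^{\otimes a}\otimes\mathcal{H}$ is an $(\alpha,a,\varepsilon)$-block encoding of $A$ if $\|A-\alpha(\langle 0|^{\otimes a}\otimes I)U(|0\rangle^{\otimes a}\otimes I)\|_\infty\le\varepsilon$, with $\|\cdot\|_\infty$ the operator norm. So $U$ is an $(\alpha,a,0)$-block encoding of $A$ iff $(\langle 0|^{\otimes a}\otimes I)U(|0\rangle^{\otimes a}\otimes I)=A/\alpha$. For the unitary $U_\rho$, write $\mathcal{U}_\rho(\cdot)=U_\rho(\cdot)U_\rho^\dagger$ and $\mathcal{U}_\rho^\dagger(\cdot)=U_\rho^\dagger(\cdot)U_\rho$. The symbol $\mathcal{E}_\rho^{\dagger}$ does not denote the adjoint of $\mathcal{E}_\rho$; it is just the name of a second channel, approximating $\mathcal{U}_\rho^\dagger$. $\|\cdot\|_\diamond$ is the diamond norm. An algorithm that uses $n$ copies of $\rho$ to implement a single use of each of $\mathcal{E}_\rho$ and $\mathcal{E}_\rho^\dagger$ means: there are fixed quantum channels $\Lambda,\Lambda'$, independent of $\rho$, such that for all $\rho$, $\mathcal{E}_\rho(\cdot)=\Lambda(\,\cdot\otimes\rho^{\otimes n})$ and $\mathcal{E}_\rho^\dagger(\cdot)=\Lambda'(\,\cdot\otimes\rho^{\otimes n})$. *)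

theory Defs
  imports
    "Jordan_Normal_Form.Schur_Decomposition"
    "Jordan_Normal_Form.Spectral_Radius"
    "HOL-Library.Extended_Real"
begin

text \<open>
  Operators between finite-dimensional Hilbert spaces are complex matrices with explicit
  dimensions, so that the dimensions, the number of ancilla qubits and the number of copies
  can be quantified inside a formula. A map on operators is a function on
  \<^typ>\<open>complex mat\<close>; only its values on the matrices of its input dimension matter.
\<close>

subsection \<open>Matrices, tensor products and norms\<close>

definition mtrace :: "complex mat \<Rightarrow> complex" where
  "mtrace A = (\<Sum>i<dim_row A. A $$ (i, i))"

text \<open>
  The order on \<^typ>\<open>complex\<close> is the one for which \<open>0 \<le> z\<close> means that \<open>z\<close> is real and
  nonnegative. So this is positivity of \<open>\<langle>v, A v\<rangle>\<close> for all \<open>v\<close>, which over the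
  complex numbers includes that \<open>A\<close> is Hermitian.
\<close>
definition psd :: "nat \<Rightarrow> complex mat \<Rightarrow> bool" where
  "psd m A \<longleftrightarrow> A \<in> carrier_mat m m \<and> (\<forall>v \<in> carrier_vec m. 0 \<le> (A *\<^sub>v v) \<bullet>c v)"

definition density_operator :: "nat \<Rightarrow> complex mat \<Rightarrow> bool" where
  "density_operator d \<rho> \<longleftrightarrow> psd d \<rho> \<and> mtrace \<rho> = 1"

definition unitary_mat :: "nat \<Rightarrow> complex mat \<Rightarrow> bool" where
  "unitary_mat m U \<longleftrightarrow> U \<in> carrier_mat m m \<and>
     mat_adjoint U * U = 1\<^sub>m m \<and> U * mat_adjoint U = 1\<^sub>m m"

text \<open>Kronecker product; the basis vector \<open>e\<^sub>i \<otimes> e\<^sub>r\<close> has index \<open>i * k + r\<close>,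
  where \<open>k\<close> is the dimension of the second factor.\<close>
definition kron :: "complex mat \<Rightarrow> complex mat \<Rightarrow> complex mat" where
  "kron A B = mat (dim_row A * dim_row B) (dim_col A * dim_col B)
     (\<lambda>(i, j). A $$ (i div dim_row B, j div dim_col B) * B $$ (i mod dim_row B, j mod dim_col B))"

primrec tensor_pow :: "complex mat \<Rightarrow> nat \<Rightarrow> complex mat" where
  "tensor_pow A 0 = 1\<^sub>m 1"
| "tensor_pow A (Suc n) = kron A (tensor_pow A n)"

definition l2_norm :: "complex vec \<Rightarrow> real" where
  "l2_norm v = sqrt (Re (v \<bullet>c v))"

text \<open>The suprema in \<open>op_norm\<close> and in \<open>diamond_norm\<close> below are taken in \<^typ>\<open>ereal\<close>, so that
  they are meaningful without a separate proof of boundedness.\<close>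
definition op_norm :: "complex mat \<Rightarrow> ereal" where
  "op_norm A = (SUP v \<in> {v \<in> carrier_vec (dim_col A). l2_norm v \<le> 1}. ereal (l2_norm (A *\<^sub>v v)))"

text \<open>The sum of the singular values, that is, of the square roots of the eigenvalues of
  \<open>A\<^sup>\<dagger> A\<close> counted with algebraic multiplicity.\<close>
definition trace_norm :: "complex mat \<Rightarrow> real" where
  "trace_norm A = (let B = mat_adjoint A * A in
     \<Sum>\<mu> \<in> spectrum B. real (order \<mu> (char_poly B)) * sqrt (Re \<mu>))"

subsection \<open>Quantum channels and the diamond norm\<close>

text \<open>
  \<open>tensor_id m p k \<Phi>\<close> is \<open>\<Phi> \<otimes> id\<close> with the identity acting on \<open>k\<times>k\<close> matrices, for \<open>\<Phi>\<close> from
  \<open>m\<times>m\<close> to \<open>p\<times>p\<close> matrices: writing \<open>X = \<Sum>\<^sub>r\<^sub>s X\<^sub>r\<^sub>s \<otimes> |r\<rangle>\<langle>s|\<close>, it maps \<open>X\<close> to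
  \<open>\<Sum>\<^sub>r\<^sub>s \<Phi>(X\<^sub>r\<^sub>s) \<otimes> |r\<rangle>\<langle>s|\<close>, with the index convention of \<open>kron\<close>.
\<close>
definition tensor_id ::
  "nat \<Rightarrow> nat \<Rightarrow> nat \<Rightarrow> (complex mat \<Rightarrow> complex mat) \<Rightarrow> complex mat \<Rightarrow> complex mat" where
  "tensor_id m p k \<Phi> X = mat (p * k) (p * k) (\<lambda>(i, j).
     \<Phi> (mat m m (\<lambda>(x, y). X $$ (x * k + i mod k, y * k + j mod k))) $$ (i div k, j div k))"

definition linear_map :: "nat \<Rightarrow> nat \<Rightarrow> (complex mat \<Rightarrow> complex mat) \<Rightarrow> bool" where
  "linear_map m p \<Phi> \<longleftrightarrow>
     (\<forall>X \<in> carrier_mat m m. \<Phi> X \<in> carrier_mat p p) \<and>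
     (\<forall>X \<in> carrier_mat m m. \<forall>Y \<in> carrier_mat m m. \<Phi> (X + Y) = \<Phi> X + \<Phi> Y) \<and>
     (\<forall>c. \<forall>X \<in> carrier_mat m m. \<Phi> (c \<cdot>\<^sub>m X) = c \<cdot>\<^sub>m \<Phi> X)"

definition completely_positive :: "nat \<Rightarrow> nat \<Rightarrow> (complex mat \<Rightarrow> complex mat) \<Rightarrow> bool" where
  "completely_positive m p \<Phi> \<longleftrightarrow>
     (\<forall>k>0. \<forall>X. psd (m * k) X \<longrightarrow> psd (p * k) (tensor_id m p k \<Phi> X))"

definition trace_preserving :: "nat \<Rightarrow> (complex mat \<Rightarrow> complex mat) \<Rightarrow> bool" where
  "trace_preserving m \<Phi> \<longleftrightarrow> (\<forall>X \<in> carrier_mat m m. mtrace (\<Phi> X) = mtrace X)"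

definition quantum_channel :: "nat \<Rightarrow> nat \<Rightarrow> (complex mat \<Rightarrow> complex mat) \<Rightarrow> bool" where
  "quantum_channel m p \<Phi> \<longleftrightarrow>
     linear_map m p \<Phi> \<and> completely_positive m p \<Phi> \<and> trace_preserving m \<Phi>"

definition diamond_norm :: "nat \<Rightarrow> nat \<Rightarrow> (complex mat \<Rightarrow> complex mat) \<Rightarrow> ereal" where
  "diamond_norm m p \<Phi> =
     (SUP k \<in> {0<..}. SUP X \<in> {X \<in> carrier_mat (m * k) (m * k). trace_norm X \<le> 1}.
        ereal (trace_norm (tensor_id m p k \<Phi> X)))"

subsection \<open>Block encodings\<close>

definition ket0 :: "complex mat" where
  "ket0 = mat 2 1 (\<lambda>(i, j). if i = 0 then 1 else 0)"

definition block_encoding ::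
  "real \<Rightarrow> nat \<Rightarrow> nat \<Rightarrow> real \<Rightarrow> complex mat \<Rightarrow> complex mat \<Rightarrow> bool" where
  "block_encoding \<alpha> a d \<epsilon> U A \<longleftrightarrow> unitary_mat (2 ^ a * d) U \<and>
     op_norm (A - complex_of_real \<alpha> \<cdot>\<^sub>m
       (kron (mat_adjoint (tensor_pow ket0 a)) (1\<^sub>m d) * U * kron (tensor_pow ket0 a) (1\<^sub>m d)))
     \<le> ereal \<epsilon>"

end

theory Submission
  imports Defs "HOL-Analysis.L2_Norm"
begin

text \<open>
  Take \<open>\<rho>\<close>, \<open>\<rho>'\<close> diagonal with entries \<open>(1 \<plusminus> \<delta>) / 2\<close> and \<open>(1 \<mp> \<delta>) / 2\<close> on the first two basis
  vectors, where \<open>\<delta>\<^sup>2\<close> is of order \<open>1 / n\<close>. Then \<open>\<rho>\<^sup>\<otimes>\<^sup>n\<close> and \<open>\<rho>'\<^sup>\<otimes>\<^sup>n\<close> both dominate a diagonal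
  operator \<open>\<sigma>\<close> of trace at least \<open>1 / 4\<close>. Feed \<open>|0\<rangle>\<langle>0|\<close> into the channel with program \<open>\<sigma>\<close>. The
  required outputs \<open>u = U\<^sub>\<rho>|0\<rangle>\<close> and \<open>u' = U\<^sub>\<rho>\<^sub>'|0\<rangle>\<close> are pure, and the defect \<open>tr E - \<langle>u, E u\<rangle>\<close> is linear
  in the program, so the single output \<open>E\<close> has defect at most \<open>\<epsilon>\<close> with respect to both \<open>u\<close> and \<open>u'\<close>.
  The block encoding condition fixes their first components to be \<open>(1 \<plusminus> \<delta>) / (2 \<alpha>)\<close>, whose
  squares differ by \<open>\<delta> / \<alpha>\<^sup>2\<close>. As infidelity is quadratic in the distance of pure states, this
  forces \<open>\<delta>\<^sup>2 / \<alpha>\<^sup>4 = O(\<epsilon>)\<close>, that is, \<open>1 / n = O(\<epsilon>)\<close>.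
\<close>

subsection \<open>The trace norm through eigenvalues\<close>

lemma mat_adjoint_dims [simp]:
  "dim_row (mat_adjoint A) = dim_col A" "dim_col (mat_adjoint A) = dim_row A"
  by (simp_all add: mat_adjoint_def)

lemma mat_adjoint_carrier [simp]:
  "A \<in> carrier_mat m n \<Longrightarrow> mat_adjoint A \<in> carrier_mat n m"
  by auto

lemma mat_adjoint_index [simp]:
  fixes A :: "complex mat"
  shows "i < dim_col A \<Longrightarrow> j < dim_row A \<Longrightarrow> mat_adjoint A $$ (i, j) = cnj (A $$ (j, i))"
  by (simp add: mat_adjoint_def mat_of_rows_def)

lemma mult_mat_index:
  assumes "A \<in> carrier_mat n m" "B \<in> carrier_mat m k" "i < n" "j < k"
  shows "(A * B) $$ (i, j) = (\<Sum>l<m. A $$ (i, l) * B $$ (l, j))"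
  using assms by (simp add: scalar_prod_def atLeast0LessThan)

lemma mtrace_mult_commute:
  assumes "A \<in> carrier_mat n m" "B \<in> carrier_mat m n"
  shows "mtrace (A * B) = mtrace (B * A)"
proof -
  have "mtrace (A * B) = (\<Sum>i<n. \<Sum>k<m. A $$ (i, k) * B $$ (k, i))"
    using assms by (simp add: mtrace_def scalar_prod_def atLeast0LessThan)
  also have "\<dots> = (\<Sum>k<m. \<Sum>i<n. B $$ (k, i) * A $$ (i, k))"
    by (subst sum.swap) (simp add: mult.commute)
  also have "\<dots> = mtrace (B * A)"
    using assms by (simp add: mtrace_def scalar_prod_def atLeast0LessThan)
  finally show ?thesis .
qed

lemma mtrace_similar:
  assumes "similar_mat A B"
  shows "mtrace A = mtrace B"
proof -
  obtain n P Q where c: "A \<in> carrier_mat n n" "B \<in> carrier_mat n n" "P \<in> carrier_mat n n"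
      "Q \<in> carrier_mat n n" and "Q * P = 1\<^sub>m n" and A: "A = P * B * Q"
    using similar_matD[OF assms] by blast
  have "mtrace A = mtrace (Q * (P * B))"
    unfolding A using c by (intro mtrace_mult_commute[of _ n n]) auto
  also have "Q * (P * B) = B"
    using c \<open>Q * P = 1\<^sub>m n\<close> by (metis assoc_mult_mat left_mult_one_mat)
  finally show ?thesis .
qed

lemma order_prod_linear:
  fixes as :: "complex list"
  shows "order x (\<Prod>a\<leftarrow>as. [:- a, 1:]) = count_list as x"
proof (induction as)
  case (Cons a as)
  have nz: "(\<Prod>a\<leftarrow>as. [:- a, 1:]) \<noteq> (0 :: complex poly)"
    by (auto simp: prod_list_zero_iff)
  have "order x [:- a, 1:] = (if a = x then 1 else 0)"
    using order_power_n_n[of x 1] by (auto intro: order_0I)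
  then show ?case
    using Cons nz by (simp add: order_mult del: mult_pCons_left)
qed simp

text \<open>\<open>trace_norm\<close> sums over the set of eigenvalues weighted by multiplicity; the
  order of a root counts its occurrences among the linear factors, which turns this into a sum over
  a list with repetitions.\<close>

lemma spectral_sum_eq:
  fixes B :: "complex mat"
  assumes "char_poly B = (\<Prod>a\<leftarrow>as. [:- a, 1:])" "B \<in> carrier_mat n n"
  shows "(\<Sum>\<mu> \<in> spectrum B. real (order \<mu> (char_poly B)) * f \<mu>) = sum_list (map f as)"
proof -
  have "spectrum B = set as"
    unfolding spectrum_def using assms
    by (auto simp: eigenvalue_root_char_poly poly_prod_list prod_list_zero_iff)
  then have "(\<Sum>\<mu> \<in> spectrum B. real (order \<mu> (char_poly B)) * f \<mu>)
    = (\<Sum>\<mu> \<in> set as. real (count_list as \<mu>) * f \<mu>)"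
    by (simp add: assms order_prod_linear)
  also have "\<dots> = sum_list (map f as)"
  proof (induction as)
    case (Cons a as)
    have "(\<Sum>\<mu> \<in> set (a # as). real (count_list (a # as) \<mu>) * f \<mu>)
      = (\<Sum>\<mu> \<in> set (a # as). (if a = \<mu> then f \<mu> else 0) + real (count_list as \<mu>) * f \<mu>)"
      by (intro sum.cong) (auto simp: algebra_simps)
    also have "\<dots> = f a + (\<Sum>\<mu> \<in> set (a # as). real (count_list as \<mu>) * f \<mu>)"
      by (simp only: sum.distrib) (simp add: sum.delta')
    also have "(\<Sum>\<mu> \<in> set (a # as). real (count_list as \<mu>) * f \<mu>)
      = (\<Sum>\<mu> \<in> set as. real (count_list as \<mu>) * f \<mu>)"
      by (intro sum.mono_neutral_right) (auto simp: count_notin)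
    finally show ?case using Cons by simp
  qed simp
  finally show ?thesis .
qed

text \<open>Schur triangularisation: the trace is invariant under similarity, and the diagonal of
  the triangular form lists the roots of the characteristic polynomial.\<close>

lemma mtrace_eq_sum_eigenvalues:
  assumes "B \<in> carrier_mat n n"
  obtains as where "char_poly B = (\<Prod>a\<leftarrow>as. [:- a, 1:])" "mtrace B = sum_list as"
    "\<And>a. a \<in> set as \<Longrightarrow> eigenvalue B a"
proof -
  obtain as where as: "char_poly B = (\<Prod>a\<leftarrow>as. [:- a, 1:])"
    using char_poly_factorized[OF assms] by blast
  obtain T P Q where T: "schur_decomposition B as = (T, P, Q)"
    by (cases "schur_decomposition B as")
  have "similar_mat_wit B T P Q" "diag_mat T = as"
    using schur_decomposition[OF assms as T] by auto
  have "mtrace B = mtrace T"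
    using \<open>similar_mat_wit B T P Q\<close> by (intro mtrace_similar) (auto simp: similar_mat_def)
  also have "\<dots> = sum_list (diag_mat T)"
    by (simp add: mtrace_def diag_mat_def sum_list_sum_nth atLeast0LessThan)
  finally have "mtrace B = sum_list as"
    using \<open>diag_mat T = as\<close> by simp
  moreover have "eigenvalue B a" if "a \<in> set as" for a
    using that as by (auto simp: eigenvalue_root_char_poly[OF assms] poly_prod_list prod_list_zero_iff)
  ultimately show ?thesis using that as by blast
qed

lemma cscalar_prod_self: "v \<bullet>c v = complex_of_real (\<Sum>i<dim_vec v. (cmod (v $ i))\<^sup>2)"
  by (simp add: scalar_prod_def atLeast0LessThan complex_norm_square del: of_real_power)

text \<open>For an eigenvector v of the Gram matrix, \<mu> times the squared norm of v is the
  squared norm of A v, so \<mu> is a quotient of nonnegative reals.\<close>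

lemma eigenvalue_gram_nonneg:
  assumes "eigenvalue (mat_adjoint A * A) \<mu>"
  shows "0 \<le> Re \<mu>"
proof -
  define n m where "n = dim_col A" "m = dim_row A"
  have A: "A \<in> carrier_mat m n" by (auto simp: n_m_def)
  obtain v where v: "v \<in> carrier_vec n" "v \<noteq> 0\<^sub>v n"
    and ev: "(mat_adjoint A * A) *\<^sub>v v = \<mu> \<cdot>\<^sub>v v"
    using assms by (auto simp: eigenvalue_def eigenvector_def n_m_def)
  have "(A *\<^sub>v v) \<bullet>c (A *\<^sub>v v) = (mat_adjoint A *\<^sub>v (A *\<^sub>v v)) \<bullet>c v"
  proof -
    define w where "w = A *\<^sub>v v"
    have w: "w \<in> carrier_vec m" using A v by (simp add: w_def)
    have "w \<bullet>c w = (\<Sum>i<m. w $ i * (\<Sum>j<n. cnj (A $$ (i, j)) * cnj (v $ j)))"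
      using A v w by (subst (2) w_def) (simp add: scalar_prod_def atLeast0LessThan)
    also have "\<dots> = (\<Sum>j<n. \<Sum>i<m. cnj (A $$ (i, j)) * w $ i * cnj (v $ j))"
      by (subst sum.swap) (simp add: sum_distrib_left mult_ac)
    also have "\<dots> = (mat_adjoint A *\<^sub>v w) \<bullet>c v"
      using A v w by (simp add: scalar_prod_def atLeast0LessThan sum_distrib_right)
    finally show ?thesis unfolding w_def .
  qed
  also have "mat_adjoint A *\<^sub>v (A *\<^sub>v v) = \<mu> \<cdot>\<^sub>v v"
    using ev A v by (metis assoc_mult_mat_vec mat_adjoint_carrier)
  also have "(\<mu> \<cdot>\<^sub>v v) \<bullet>c v = \<mu> * (v \<bullet>c v)"
    using v by simp
  finally have eq: "\<mu> * (v \<bullet>c v) = (A *\<^sub>v v) \<bullet>c (A *\<^sub>v v)" by simp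
  define r s where "r = (\<Sum>i<dim_vec v. (cmod (v $ i))\<^sup>2)"
    "s = (\<Sum>i<m. (cmod ((A *\<^sub>v v) $ i))\<^sup>2)"
  have "complex_of_real r \<noteq> 0"
    using v conjugate_square_eq_0_vec[OF v(1)] unfolding r_s_def cscalar_prod_self[symmetric] by simp
  moreover have "\<mu> * complex_of_real r = complex_of_real s"
    using eq A unfolding cscalar_prod_self r_s_def by simp
  ultimately have "\<mu> = complex_of_real (s / r)"
    by (simp add: field_simps)
  moreover have "0 \<le> s / r"
    by (auto simp: r_s_def intro!: divide_nonneg_nonneg sum_nonneg)
  ultimately show ?thesis by simp
qed

lemma mtrace_gram:
  assumes "A \<in> carrier_mat m n"
  shows "mtrace (mat_adjoint A * A) = complex_of_real (\<Sum>j<n. \<Sum>i<m. (cmod (A $$ (i, j)))\<^sup>2)"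
  using assms
  by (simp add: mtrace_def scalar_prod_def atLeast0LessThan complex_norm_square mult.commute
      del: of_real_power)

lemma sqrt_sum_list_le:
  assumes "\<And>x. x \<in> set xs \<Longrightarrow> 0 \<le> f x"
  shows "sqrt (sum_list (map f xs)) \<le> (\<Sum>x\<leftarrow>xs. sqrt (f x))"
  using assms
proof (induction xs)
  case (Cons x xs)
  have "0 \<le> sum_list (map f xs)" using Cons.prems by (intro sum_list_nonneg) auto
  then have "sqrt (sum_list (map f (x # xs))) \<le> sqrt (f x) + sqrt (sum_list (map f xs))"
    using Cons.prems by (simp add: sqrt_add_le_add_sqrt)
  then show ?case using Cons by force
qed simp

text \<open>The left side is the l2 norm of the singular values and the right side their l1 norm. It
  converts trace norm bounds into bounds on matrix entries.\<close>

lemma frobenius_le_trace_norm: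
  assumes "A \<in> carrier_mat n n"
  shows "sqrt (\<Sum>j<n. \<Sum>i<n. (cmod (A $$ (i, j)))\<^sup>2) \<le> trace_norm A"
proof -
  let ?B = "mat_adjoint A * A"
  have B: "?B \<in> carrier_mat n n" using assms by auto
  obtain as where as: "char_poly ?B = (\<Prod>a\<leftarrow>as. [:- a, 1:])" "mtrace ?B = sum_list as"
    "\<And>a. a \<in> set as \<Longrightarrow> eigenvalue ?B a"
    using mtrace_eq_sum_eigenvalues[OF B] by blast
  have "Re (sum_list as) = sum_list (map Re as)" by (induction as) auto
  then have "(\<Sum>j<n. \<Sum>i<n. (cmod (A $$ (i, j)))\<^sup>2) = sum_list (map Re as)"
    using arg_cong[OF mtrace_gram[OF assms], of Re] unfolding as(2) by simp
  moreover have "sqrt (sum_list (map Re as)) \<le> (\<Sum>a\<leftarrow>as. sqrt (Re a))"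
    using as(3) eigenvalue_gram_nonneg by (intro sqrt_sum_list_le) blast
  moreover have "trace_norm A = (\<Sum>a\<leftarrow>as. sqrt (Re a))"
    unfolding trace_norm_def Let_def by (rule spectral_sum_eq[OF as(1) B])
  ultimately show ?thesis by simp
qed

text \<open>Idempotence forces every eigenvalue to satisfy a = a * a, hence to be 0 or 1 and its own
  square root.\<close>

lemma trace_norm_projection:
  assumes "A \<in> carrier_mat n n" "mat_adjoint A = A" "A * A = A"
  shows "trace_norm A = Re (mtrace A)"
proof -
  have B: "mat_adjoint A * A = A" by (simp add: assms)
  obtain as where as: "char_poly A = (\<Prod>a\<leftarrow>as. [:- a, 1:])" "mtrace A = sum_list as"
    "\<And>a. a \<in> set as \<Longrightarrow> eigenvalue A a"
    using mtrace_eq_sum_eigenvalues[OF assms(1)] by blast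
  have "sqrt (Re a) = Re a" if "a \<in> set as" for a
  proof -
    obtain v where v: "v \<in> carrier_vec n" "v \<noteq> 0\<^sub>v n" and ev: "A *\<^sub>v v = a \<cdot>\<^sub>v v"
      using as(3)[OF \<open>a \<in> set as\<close>] assms(1) by (auto simp: eigenvalue_def eigenvector_def)
    have "a \<cdot>\<^sub>v v = A *\<^sub>v (A *\<^sub>v v)"
      using assms(1,3) v ev by (metis assoc_mult_mat_vec)
    also have "\<dots> = (a * a) \<cdot>\<^sub>v v"
      using assms(1) v ev by (simp add: mult_mat_vec smult_smult_assoc)
    finally have eq: "a \<cdot>\<^sub>v v = (a * a) \<cdot>\<^sub>v v" .
    obtain i where i: "i < n" "v $ i \<noteq> 0"
      using v by (metis carrier_vecD eq_vecI index_zero_vec)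
    have "a * v $ i = a * a * v $ i"
      using arg_cong[OF eq, of "\<lambda>w. w $ i"] i v by simp
    then show ?thesis using i by auto
  qed
  then have "trace_norm A = sum_list (map Re as)"
    unfolding trace_norm_def Let_def B
    by (subst spectral_sum_eq[OF as(1) assms(1)]) (metis (no_types, lifting) map_eq_conv)
  also have "\<dots> = Re (mtrace A)" unfolding as(2) by (induction as) auto
  finally show ?thesis .
qed

subsection \<open>Positive forms\<close>

text \<open>Vectors are plain functions of which only the values below \<open>n\<close> count, so
  that sums and multiples carry no dimension conditions.\<close>

definition sform :: "nat \<Rightarrow> complex mat \<Rightarrow> (nat \<Rightarrow> complex) \<Rightarrow> (nat \<Rightarrow> complex) \<Rightarrow> complex" where
  "sform n A x y = (\<Sum>i<n. \<Sum>j<n. cnj (x i) * A $$ (i, j) * y j)"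

abbreviation qform :: "nat \<Rightarrow> complex mat \<Rightarrow> (nat \<Rightarrow> complex) \<Rightarrow> real" where
  "qform n A x \<equiv> Re (sform n A x x)"

lemma sform_linear:
  "sform n A (\<lambda>i. x i + y i) z = sform n A x z + sform n A y z"
  "sform n A z (\<lambda>i. x i + y i) = sform n A z x + sform n A z y"
  "sform n A (\<lambda>i. c * x i) z = cnj c * sform n A x z"
  "sform n A z (\<lambda>i. c * x i) = c * sform n A z x"
  by (simp_all add: sform_def algebra_simps sum.distrib sum_distrib_left)

lemma sform_mat_add:
  assumes "A \<in> carrier_mat n n" "B \<in> carrier_mat n n"
  shows "sform n (A + B) x y = sform n A x y + sform n B x y"
    and "sform n (A - B) x y = sform n A x y - sform n B x y"
  using assms by (simp_all add: sform_def algebra_simps sum.distrib sum_subtractf)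

lemma qform_nonneg:
  assumes "psd n A"
  shows "0 \<le> qform n A x"
proof -
  have A: "A \<in> carrier_mat n n" and pos: "0 \<le> (A *\<^sub>v vec n x) \<bullet>c vec n x"
    using assms by (auto simp: psd_def)
  have "(A *\<^sub>v vec n x) \<bullet>c vec n x = sform n A x x"
    using A by (simp add: sform_def scalar_prod_def atLeast0LessThan sum_distrib_left mult_ac)
  then show ?thesis using pos by (simp add: less_eq_complex_def)
qed

text \<open>Weighted Young inequality for a positive semidefinite form: positivity at t x - y bounds
  the cross terms, and the weight t is left free for later optimisation.\<close>

lemma qform_add_le:
  assumes "psd n A" "t > 0"
  shows "qform n A (\<lambda>i. x i + y i) \<le> (1 + t) * qform n A x + (1 + 1 / t) * qform n A y"
proof -
  have "0 \<le> qform n A (\<lambda>i. of_real t * x i + (-1) * y i)"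
    by (rule qform_nonneg[OF assms(1)])
  also have "\<dots> = t\<^sup>2 * qform n A x + qform n A y - t * Re (sform n A x y + sform n A y x)"
    unfolding sform_linear by (simp add: power2_eq_square algebra_simps)
  finally have "t * Re (sform n A x y + sform n A y x) \<le> t * (t * qform n A x + qform n A y / t)"
    using assms(2) by (simp add: power2_eq_square algebra_simps)
  then have "Re (sform n A x y + sform n A y x) \<le> t * qform n A x + qform n A y / t"
    using assms(2) by (simp only: mult_le_cancel_left_pos)
  then show ?thesis
    unfolding sform_linear by (simp add: algebra_simps)
qed

definition basis_fun :: "nat \<Rightarrow> nat \<Rightarrow> complex" where
  "basis_fun k i = (if i = k then 1 else 0)"

lemma sform_basis:
  assumes "k < n"
  shows "sform n A (basis_fun k) y = (\<Sum>j<n. A $$ (k, j) * y j)"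
    and "sform n A x (basis_fun k) = (\<Sum>i<n. cnj (x i) * A $$ (i, k))"
proof -
  have "sform n A (basis_fun k) y
      = (\<Sum>i<n. if i = k then \<Sum>j<n. A $$ (k, j) * y j else 0)"
    unfolding sform_def basis_fun_def by (intro sum.cong) auto
  then show "sform n A (basis_fun k) y = (\<Sum>j<n. A $$ (k, j) * y j)"
    using assms by simp
  have "sform n A x (basis_fun k)
      = (\<Sum>i<n. \<Sum>j<n. if j = k then cnj (x i) * A $$ (i, k) else 0)"
    unfolding sform_def basis_fun_def by (intro sum.cong) auto
  then show "sform n A x (basis_fun k) = (\<Sum>i<n. cnj (x i) * A $$ (i, k))"
    using assms by simp
qed

lemma sform_basis_basis: "k < n \<Longrightarrow> sform n A (basis_fun k) (basis_fun k) = A $$ (k, k)"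
proof -
  assume "k < n"
  have "(\<Sum>j<n. A $$ (k, j) * basis_fun k j) = (\<Sum>j<n. if j = k then A $$ (k, k) else 0)"
    by (intro sum.cong) (auto simp: basis_fun_def)
  then show ?thesis using \<open>k < n\<close> by (simp add: sform_basis(1))
qed

text \<open>The vectors on the left are the images of the standard basis under the projection onto
  the orthogonal complement of \<open>u\<close>, so the sum is the trace of \<open>A\<close>
  compressed to that complement.\<close>

lemma sum_qform_complement:
  assumes "A \<in> carrier_mat n n" "(\<Sum>i<n. (cmod (u i))\<^sup>2) = 1"
  shows "(\<Sum>k<n. qform n A (\<lambda>i. basis_fun k i + (- cnj (u k)) * u i)) = Re (mtrace A) - qform n A u"
proof -
  have one: "(\<Sum>k<n. u k * cnj (u k)) = 1"
  proof -
    have "(\<Sum>k<n. u k * cnj (u k)) = complex_of_real (\<Sum>i<n. (cmod (u i))\<^sup>2)"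
      by (simp add: complex_norm_square del: of_real_power)
    then show ?thesis using assms(2) by simp
  qed
  \<comment> \<open>Both cross sums and, as \<open>u\<close> is normalised, the last term equal the
    form at \<open>u\<close>; with their signs exactly one negative copy survives.\<close>
  have "(\<Sum>k<n. sform n A (\<lambda>i. basis_fun k i + (- cnj (u k)) * u i)
          (\<lambda>i. basis_fun k i + (- cnj (u k)) * u i))
      = (\<Sum>k<n. A $$ (k, k)) - (\<Sum>k<n. cnj (u k) * sform n A (basis_fun k) u)
        - (\<Sum>k<n. u k * sform n A u (basis_fun k)) + (\<Sum>k<n. u k * cnj (u k)) * sform n A u u"
    unfolding sform_linear
    by (simp add: sform_basis_basis algebra_simps sum.distrib sum_subtractf)
      (simp add: sum_distrib_left mult_ac)
  also have "(\<Sum>k<n. cnj (u k) * sform n A (basis_fun k) u) = sform n A u u"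
    by (simp add: sform_basis(1) sum_distrib_left) (simp add: sform_def mult_ac)
  also have "(\<Sum>k<n. u k * sform n A u (basis_fun k)) = sform n A u u"
    by (simp add: sform_basis(2) sum_distrib_left) (subst sum.swap, simp add: sform_def mult_ac)
  finally show ?thesis
    using assms(1) one by (simp add: mtrace_def flip: Re_sum)
qed

lemma qform_le_trace:
  assumes "psd n A" "(\<Sum>i<n. (cmod (u i))\<^sup>2) = 1"
  shows "qform n A u \<le> Re (mtrace A)"
proof -
  have "0 \<le> (\<Sum>k<n. qform n A (\<lambda>i. basis_fun k i + (- cnj (u k)) * u i))"
    by (intro sum_nonneg qform_nonneg[OF assms(1)])
  then show ?thesis
    using sum_qform_complement[of A n u] assms by (simp add: psd_def)
qed

text \<open>Splitting \<open>e\<^sub>k\<close> into its component along \<open>u\<close> and the rest \<open>v\<close>, the form of \<open>A\<close> at \<open>v\<close>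
  is one of the nonnegative terms adding up to \<open>tr A - \<langle>u, A u\<rangle>\<close>.\<close>
lemma diag_entry_approx:
  assumes psd: "psd n A" and u: "(\<Sum>i<n. (cmod (u i))\<^sup>2) = 1"
    and close: "Re (mtrace A) - \<epsilon> \<le> qform n A u" and k: "k < n" and t: "t > 0"
  shows "\<bar>Re (A $$ (k, k)) - (cmod (u k))\<^sup>2 * Re (mtrace A)\<bar>
    \<le> t * Re (mtrace A) + (2 + 1 / t) * \<epsilon>"
proof -
  define \<tau> z where "\<tau> = Re (mtrace A)" "z = (cmod (u k))\<^sup>2"
  define x v where "x = (\<lambda>i. cnj (u k) * u i)" "v = (\<lambda>i. basis_fun k i + (- cnj (u k)) * u i)"
  have A: "A \<in> carrier_mat n n" using psd by (simp add: psd_def)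
  have "z \<le> (\<Sum>i<n. (cmod (u i))\<^sup>2)"
    unfolding \<tau>_z_def using k by (intro member_le_sum) auto
  then have z: "0 \<le> z" "z \<le> 1" using u by (auto simp: \<tau>_z_def)
  have qu: "qform n A u \<le> \<tau>" "0 \<le> qform n A u"
    using qform_le_trace[OF psd u] qform_nonneg[OF psd] by (auto simp: \<tau>_z_def)
  have "qform n A v \<le> (\<Sum>k<n. qform n A (\<lambda>i. basis_fun k i + (- cnj (u k)) * u i))"
    unfolding x_v_def by (rule member_le_sum) (use k qform_nonneg[OF psd] in auto)
  then have qv: "qform n A v \<le> \<epsilon>" "0 \<le> qform n A v"
    using sum_qform_complement[OF A u] close qform_nonneg[OF psd] by auto
  have qe: "qform n A (basis_fun k) = Re (A $$ (k, k))"
    by (simp add: sform_basis_basis k)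
  have "qform n A (basis_fun k) \<le> (\<Sum>k<n. qform n A (basis_fun k))"
    by (rule member_le_sum) (use k qform_nonneg[OF psd] in auto)
  also have "\<dots> = \<tau>" using A by (simp add: sform_basis_basis \<tau>_z_def mtrace_def)
  finally have e: "Re (A $$ (k, k)) \<le> \<tau>" "0 \<le> Re (A $$ (k, k))"
    using qe qform_nonneg[OF psd, of "basis_fun k"] by auto
  have "sform n A x x = complex_of_real z * sform n A u u"
    unfolding x_v_def \<tau>_z_def sform_linear complex_norm_square by (simp add: mult_ac)
  then have qx: "qform n A x = z * qform n A u" by simp
  have neg: "qform n A (\<lambda>i. (- 1) * v i) = qform n A v"
    by (simp only: sform_linear) simp
  have eqs: "(\<lambda>i. x i + v i) = basis_fun k" "(\<lambda>i. basis_fun k i + (- 1) * v i) = x"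
    by (auto simp: x_v_def)
  \<comment> \<open>The Young inequality is applied to e_k = x + v and to x = e_k - v, giving the
    upper and the lower estimate.\<close>
  have "Re (A $$ (k, k)) \<le> (1 + t) * (z * qform n A u) + (1 + 1 / t) * qform n A v"
    "z * qform n A u \<le> (1 + t) * Re (A $$ (k, k)) + (1 + 1 / t) * qform n A v"
    using qform_add_le[OF psd t, of x v] qform_add_le[OF psd t, of "basis_fun k" "\<lambda>i. (-1) * v i"]
    by (simp_all only: eqs neg qx qe)
  moreover have "(1 + 1 / t) * qform n A v \<le> (1 + 1 / t) * \<epsilon>"
    using qv t by (intro mult_left_mono) auto
  moreover have "z * qform n A u \<le> z * \<tau>" "z * (\<tau> - \<epsilon>) \<le> z * qform n A u"
    using z qu close qv by (auto intro!: mult_left_mono simp: \<tau>_z_def(1))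
  moreover have "z * \<tau> \<le> \<tau>" "z * \<epsilon> \<le> \<epsilon>"
    using mult_right_mono[of z 1] z qu qv by auto
  moreover have "t * (z * qform n A u) \<le> t * \<tau>" "t * Re (A $$ (k, k)) \<le> t * \<tau>"
    using calculation(4,6) e t by (auto intro!: mult_left_mono)
  ultimately show ?thesis
    unfolding \<tau>_z_def[symmetric] using qv by (simp add: abs_le_iff algebra_simps)
qed

text \<open>One diagonal entry of \<open>A\<close> must be close both to
  \<open>(cmod (u k))\<^sup>2\<close> and to \<open>(cmod (v k))\<^sup>2\<close> times the trace.
  Optimising the weight in the Young inequality makes the resulting bound quadratic in
  \<Delta>.\<close>

lemma trace_mult_sq_diff_le:
  assumes psd: "psd n A" and k: "k < n"
    and u: "(\<Sum>i<n. (cmod (u i))\<^sup>2) = 1" "Re (mtrace A) - \<epsilon> \<le> qform n A u"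
    and v: "(\<Sum>i<n. (cmod (v i))\<^sup>2) = 1" "Re (mtrace A) - \<epsilon> \<le> qform n A v"
    and \<Delta>: "\<Delta> = (cmod (u k))\<^sup>2 - (cmod (v k))\<^sup>2" "0 < \<Delta>"
  shows "Re (mtrace A) * \<Delta>\<^sup>2 \<le> 24 * \<epsilon>"
proof -
  define \<tau> where "\<tau> = Re (mtrace A)"
  have "(cmod (u k))\<^sup>2 \<le> (\<Sum>i<n. (cmod (u i))\<^sup>2)"
    using k by (intro member_le_sum) auto
  then have "\<Delta> \<le> 1" using \<Delta> u(1) by (simp add: order_trans[rotated])
  have "0 \<le> \<epsilon>" using qform_le_trace[OF psd u(1)] u(2) by simp
  \<comment> \<open>The weight t = \<Delta> / 4 makes the trace terms of the two estimates add up to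
    half of \<tau> \<Delta>, which the left side absorbs.\<close>
  define b where "b = (\<Delta> / 4) * \<tau> + (2 + 1 / (\<Delta> / 4)) * \<epsilon>"
  have "\<bar>Re (A $$ (k, k)) - (cmod (u k))\<^sup>2 * \<tau>\<bar> \<le> b" "\<bar>Re (A $$ (k, k)) - (cmod (v k))\<^sup>2 * \<tau>\<bar> \<le> b"
    unfolding b_def \<tau>_def using \<Delta>(2)
    by (intro diag_entry_approx[OF psd u k] diag_entry_approx[OF psd v k]; simp)+
  then have "(cmod (u k))\<^sup>2 * \<tau> - (cmod (v k))\<^sup>2 * \<tau> \<le> 2 * b" by linarith
  then have "\<tau> * \<Delta> \<le> 2 * ((\<Delta> / 4) * \<tau> + (2 + 1 / (\<Delta> / 4)) * \<epsilon>)"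
    unfolding b_def[symmetric] by (simp only: \<Delta>(1) right_diff_distrib mult.commute)
  also have "\<dots> = \<tau> * \<Delta> / 2 + (4 + 8 / \<Delta>) * \<epsilon>" by (simp add: algebra_simps)
  finally have "\<tau> * \<Delta> / 2 \<le> (4 + 8 / \<Delta>) * \<epsilon>" by simp
  \<comment> \<open>Since \<Delta> \<le> 1, the right side is at most 12 \<epsilon>; clearing the
    factor 1/2 gives 24.\<close>
  then have "\<tau> * \<Delta> / 2 * \<Delta> \<le> (4 + 8 / \<Delta>) * \<epsilon> * \<Delta>"
    using \<Delta>(2) by (intro mult_right_mono) auto
  also have "\<dots> = 4 * (\<epsilon> * \<Delta>) + 8 * \<epsilon>" using \<Delta>(2) by (simp add: field_simps)
  also have "\<epsilon> * \<Delta> \<le> \<epsilon> * 1" using \<open>0 \<le> \<epsilon>\<close> \<open>\<Delta> \<le> 1\<close> by (intro mult_left_mono) auto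
  finally show ?thesis unfolding \<tau>_def power2_eq_square by simp
qed

text \<open>Cauchy-Schwarz over index pairs: the array of products of moduli of entries of
  \<open>u\<close> has Euclidean norm 1.\<close>

lemma cmod_sform_le:
  assumes "(\<Sum>i<n. (cmod (u i))\<^sup>2) = 1"
  shows "cmod (sform n A u u) \<le> sqrt (\<Sum>j<n. \<Sum>i<n. (cmod (A $$ (i, j)))\<^sup>2)"
proof -
  have "sform n A u u = (\<Sum>(i,j)\<in>{..<n} \<times> {..<n}. cnj (u i) * A $$ (i, j) * u j)"
    by (simp add: sform_def sum.cartesian_product)
  also have "cmod \<dots> \<le> (\<Sum>(i,j)\<in>{..<n} \<times> {..<n}. \<bar>cmod (A $$ (i, j))\<bar> * \<bar>cmod (u i) * cmod (u j)\<bar>)"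
    by (rule order_trans[OF norm_sum]) (auto intro!: sum_mono simp: norm_mult)
  also have "\<dots> \<le> L2_set (\<lambda>(i,j). cmod (A $$ (i, j))) ({..<n} \<times> {..<n})
      * L2_set (\<lambda>(i,j). cmod (u i) * cmod (u j)) ({..<n} \<times> {..<n})"
    using L2_set_mult_ineq[of "\<lambda>(i,j). cmod (A $$ (i, j))" "\<lambda>(i,j). cmod (u i) * cmod (u j)"]
    by (simp add: case_prod_unfold)
  also have "L2_set (\<lambda>(i,j). cmod (u i) * cmod (u j)) ({..<n} \<times> {..<n})
      = sqrt ((\<Sum>i<n. (cmod (u i))\<^sup>2) * (\<Sum>j<n. (cmod (u j))\<^sup>2))"
    unfolding L2_set_def sum_product sum.cartesian_product
    by (simp add: case_prod_unfold power_mult_distrib)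
  also have "L2_set (\<lambda>(i,j). cmod (A $$ (i, j))) ({..<n} \<times> {..<n})
      = sqrt (\<Sum>j<n. \<Sum>i<n. (cmod (A $$ (i, j)))\<^sup>2)"
    unfolding L2_set_def by (subst sum.swap) (simp add: sum.cartesian_product case_prod_unfold)
  finally show ?thesis using assms by simp
qed

subsection \<open>Diagonal matrices and their tensor powers\<close>

definition diagm :: "nat \<Rightarrow> (nat \<Rightarrow> real) \<Rightarrow> complex mat" where
  "diagm n f = mat n n (\<lambda>(i, j). if i = j then complex_of_real (f i) else 0)"

lemma diagm_carrier [simp]: "diagm n f \<in> carrier_mat n n"
  by (simp add: diagm_def)

lemma mtrace_diagm: "mtrace (diagm n f) = complex_of_real (\<Sum>i<n. f i)"
  by (simp add: mtrace_def diagm_def)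

lemma diagm_add: "diagm n (\<lambda>i. f i + g i) = diagm n f + diagm n g"
  by (rule eq_matI) (auto simp: diagm_def)

lemma psd_diagm:
  assumes "\<And>i. i < n \<Longrightarrow> 0 \<le> f i"
  shows "psd n (diagm n f)"
proof -
  have "0 \<le> (diagm n f *\<^sub>v v) \<bullet>c v" if "v \<in> carrier_vec n" for v
  proof -
    have "(diagm n f *\<^sub>v v) \<bullet>c v
        = (\<Sum>i<n. (\<Sum>j<n. (if i = j then complex_of_real (f i) * v $ j else 0)) * cnj (v $ i))"
      using that by (auto simp: diagm_def scalar_prod_def atLeast0LessThan if_distrib[of "\<lambda>x. x * _"]
          cong: if_cong intro!: sum.cong)
    also have "\<dots> = (\<Sum>i<n. complex_of_real (f i) * (v $ i * cnj (v $ i)))"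
      by (simp add: mult.assoc)
    also have "\<dots> = complex_of_real (\<Sum>i<n. f i * (cmod (v $ i))\<^sup>2)"
      by (simp add: complex_norm_square del: of_real_power)
    finally show ?thesis
      using assms by (auto simp: less_eq_complex_def intro!: sum_nonneg)
  qed
  then show ?thesis by (simp add: psd_def)
qed

lemma kron_diagm: "kron (diagm a f) (diagm b g) = diagm (a * b) (\<lambda>i. f (i div b) * g (i mod b))"
proof (rule eq_matI)
  fix i j assume "i < dim_row (diagm (a * b) (\<lambda>i. f (i div b) * g (i mod b)))"
    "j < dim_col (diagm (a * b) (\<lambda>i. f (i div b) * g (i mod b)))"
  then have ij: "i < a * b" "j < a * b" by (auto simp: diagm_def)
  then have "b > 0" by (cases b) auto
  then have "i div b < a" "j div b < a" "i mod b < b" "j mod b < b"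
    using ij by (auto simp: less_mult_imp_div_less)
  moreover have "i = j \<longleftrightarrow> i div b = j div b \<and> i mod b = j mod b"
    by (metis div_mult_mod_eq)
  ultimately show "kron (diagm a f) (diagm b g) $$ (i, j)
      = diagm (a * b) (\<lambda>i. f (i div b) * g (i mod b)) $$ (i, j)"
    using ij by (auto simp: kron_def diagm_def)
qed (auto simp: kron_def diagm_def)

text \<open>The product distribution: the index is read as \<open>n\<close> digits in base
  \<open>d\<close>, leading digit first, and the weight is the product of \<open>f\<close> over the
  digits.\<close>

primrec prod_weight :: "nat \<Rightarrow> (nat \<Rightarrow> real) \<Rightarrow> nat \<Rightarrow> nat \<Rightarrow> real" where
  "prod_weight d f 0 i = 1"
| "prod_weight d f (Suc n) i = f (i div d ^ n) * prod_weight d f n (i mod d ^ n)"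

lemma tensor_pow_diagm: "tensor_pow (diagm d f) n = diagm (d ^ n) (prod_weight d f n)"
proof (induction n)
  case 0
  show ?case by (rule eq_matI) (auto simp: diagm_def)
next
  case (Suc n)
  then show ?case by (simp add: kron_diagm)
qed

lemma prod_weight_nonneg: "(\<And>i. 0 \<le> f i) \<Longrightarrow> 0 \<le> prod_weight d f n i"
  by (induction n arbitrary: i) auto

text \<open>The geometric mean of two product weights is again a product weight, whence the
  Bhattacharyya coefficient of \<open>n\<close> copies is an \<open>n\<close>-th power.\<close>

lemma prod_weight_sqrt_mult:
  "sqrt (prod_weight d f n i * prod_weight d g n i) = prod_weight d (\<lambda>i. sqrt (f i * g i)) n i"
  by (induction n arbitrary: i) (auto simp: real_sqrt_mult mult_ac)

lemma sum_div_mod: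
  fixes f g :: "nat \<Rightarrow> real"
  shows "(\<Sum>i<a * b. f (i div b) * g (i mod b)) = (\<Sum>i<a. f i) * (\<Sum>j<b. g j)"
proof -
  have "(\<Sum>i<a * b. f (i div b) * g (i mod b))
      = (\<Sum>m<a. \<Sum>i\<in>{m * b..<m * b + b}. f (i div b) * g (i mod b))"
    by (rule sum.nat_group[symmetric])
  also have "\<dots> = (\<Sum>m<a. f m * (\<Sum>j<b. g j))"
  proof (rule sum.cong)
    fix m assume "m \<in> {..<a}"
    have "(\<Sum>i\<in>{m * b..<m * b + b}. f (i div b) * g (i mod b))
        = (\<Sum>j\<in>{0..<b}. f ((j + m * b) div b) * g ((j + m * b) mod b))"
      using sum.shift_bounds_nat_ivl[of "\<lambda>i. f (i div b) * g (i mod b)" 0 "m * b" b]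
      by (simp add: add.commute)
    then show "(\<Sum>i\<in>{m * b..<m * b + b}. f (i div b) * g (i mod b)) = f m * (\<Sum>j<b. g j)"
      by (simp add: sum_distrib_left atLeast0LessThan)
  qed simp
  finally show ?thesis by (simp add: sum_distrib_right)
qed

lemma sum_prod_weight: "(\<Sum>i<d ^ n. prod_weight d f n i) = (\<Sum>i<d. f i) ^ n"
  by (induction n) (simp_all add: sum_div_mod)

section \<open>Overlap of two product distributions\<close>

lemma min_ge_sqrt_mult:
  fixes a b :: real
  assumes "0 \<le> a" "0 \<le> b"
  shows "sqrt (a * b) - (a + b) / 4 \<le> min a b"
proof -
  \<comment> \<open>AM-GM with unequal weights; x will be the smaller and y the larger of the two
    numbers.\<close>
  have "sqrt (a * b) \<le> x + y / 4" if "0 \<le> x" "0 \<le> y" "a * b = x * y" for x y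
  proof -
    have "0 \<le> (sqrt x - sqrt y / 2)\<^sup>2" by simp
    also have "\<dots> = x + y / 4 - sqrt x * sqrt y"
      using that by (simp add: power2_eq_square algebra_simps)
    finally show ?thesis using that by (simp add: real_sqrt_mult)
  qed
  from this[of a b] this[of b a] show ?thesis
    using assms by (cases "a \<le> b") (auto simp: min_def mult.commute field_simps)
qed

lemma sum_two:
  assumes "(2::nat) \<le> d" "\<And>i. 2 \<le> i \<Longrightarrow> f i = (0::real)"
  shows "(\<Sum>i<d. f i) = f 0 + f 1"
proof -
  have "(\<Sum>i<d. f i) = (\<Sum>i<2. f i)"
    using assms by (intro sum.mono_neutral_right) auto
  then show ?thesis by (simp add: numeral_2_eq_2)
qed

definition bern :: "real \<Rightarrow> nat \<Rightarrow> real" where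
  "bern p i = (if i = 0 then p else if i = 1 then 1 - p else 0)"

lemma sum_bern: "2 \<le> d \<Longrightarrow> (\<Sum>i<d. bern p i) = 1"
  by (subst sum_two) (auto simp: bern_def)

text \<open>The sum of the pointwise minima is bounded below through the Bhattacharyya
  coefficient, which is multiplicative.\<close>
lemma overlap_bern:
  assumes d: "2 \<le> d" and \<delta>: "0 \<le> \<delta>" "\<delta> \<le> 1" "4 * real n * \<delta>\<^sup>2 \<le> 1"
  shows "1 / 4 \<le> (\<Sum>i<d ^ n. min (prod_weight d (bern ((1 + \<delta>) / 2)) n i)
    (prod_weight d (bern ((1 - \<delta>) / 2)) n i))"
proof -
  define f g where "f = bern ((1 + \<delta>) / 2)" "g = bern ((1 - \<delta>) / 2)"
  have nn: "0 \<le> f i" "0 \<le> g i" for i using \<delta> by (auto simp: f_g_def bern_def field_simps)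
  define b where "b = sqrt (1 - \<delta>\<^sup>2)"
  have "\<delta>\<^sup>2 \<le> 1" using \<delta> by (simp add: power_le_one)
  have "sqrt ((1 + \<delta>) * (1 - \<delta>) / 4) = b / 2"
    unfolding b_def by (simp add: real_sqrt_divide power2_eq_square algebra_simps)
  then have bc: "(\<Sum>i<d. sqrt (f i * g i)) = b"
    using d by (subst sum_two) (auto simp: f_g_def bern_def field_simps)
  \<comment> \<open>A number in [0, 1] is at most its square root, so Bernoulli's inequality for 1 -
    \<open>\<delta>\<^sup>2\<close> also bounds the power of \<open>b\<close> from below.\<close>
  have "1 - \<delta>\<^sup>2 \<le> b"
    unfolding b_def using \<open>\<delta>\<^sup>2 \<le> 1\<close> by (intro real_le_rsqrt) (simp add: power_le_one_iff power2_eq_square mult_left_le)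
  have "3 / 4 \<le> 1 - real n * \<delta>\<^sup>2" using \<delta>(3) by simp
  also have "\<dots> \<le> (1 - \<delta>\<^sup>2) ^ n"
    using Bernoulli_inequality[of "- \<delta>\<^sup>2" n] \<open>\<delta>\<^sup>2 \<le> 1\<close> by simp
  also have "\<dots> \<le> b ^ n"
    using \<open>1 - \<delta>\<^sup>2 \<le> b\<close> \<open>\<delta>\<^sup>2 \<le> 1\<close> by (intro power_mono) auto
  \<comment> \<open>The amount 1/2 taken from 3/4 is a quarter of the two total masses, each equal
    to 1.\<close>
  finally have "1 / 4 \<le> b ^ n - (1 ^ n + 1 ^ n) / 4" by simp
  also have "\<dots> = (\<Sum>i<d ^ n. sqrt (prod_weight d f n i * prod_weight d g n i)
      - (prod_weight d f n i + prod_weight d g n i) / 4)"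
    unfolding prod_weight_sqrt_mult sum_subtractf sum.distrib sum_divide_distrib[symmetric]
      sum_prod_weight bc
    using d by (simp add: f_g_def sum_bern)
  also have "\<dots> \<le> (\<Sum>i<d ^ n. min (prod_weight d f n i) (prod_weight d g n i))"
    by (intro sum_mono min_ge_sqrt_mult prod_weight_nonneg nn)
  finally show ?thesis unfolding f_g_def .
qed

subsection \<open>Channels and block encodings\<close>

text \<open>A one-dimensional ancilla specialises complete positivity to positivity and the diamond
  norm to a trace norm bound on single inputs.\<close>

lemma tensor_id_one:
  assumes "X \<in> carrier_mat m m" "\<Phi> X \<in> carrier_mat p p"
  shows "tensor_id m p 1 \<Phi> X = \<Phi> X"
proof -
  have "mat m m (\<lambda>(x, y). X $$ (x * 1 + i mod 1, y * 1 + j mod 1)) = X" for i j :: nat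
    using assms(1) by (intro eq_matI) auto
  then show ?thesis
    using assms(2) unfolding tensor_id_def by (intro eq_matI) auto
qed

lemma trace_norm_le_diamond_norm:
  assumes "X \<in> carrier_mat m m" "\<Phi> X \<in> carrier_mat p p" "trace_norm X \<le> 1"
    "diamond_norm m p \<Phi> \<le> ereal \<epsilon>"
  shows "trace_norm (\<Phi> X) \<le> \<epsilon>"
proof -
  have "ereal (trace_norm (tensor_id m p 1 \<Phi> X)) \<le> diamond_norm m p \<Phi>"
    unfolding diamond_norm_def using assms(1,3)
    by (intro SUP_upper2[of 1] SUP_upper) auto
  also note assms(4)
  finally show ?thesis using tensor_id_one[of X m \<Phi> p] assms(1,2) by simp
qed

lemma quantum_channel_psd:
  assumes "quantum_channel m p \<Phi>" "psd m X"
  shows "psd p (\<Phi> X)"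
proof -
  have X: "X \<in> carrier_mat m m" using assms(2) unfolding psd_def by (rule conjunct1)
  have lin: "linear_map m p \<Phi>" and cp: "completely_positive m p \<Phi>"
    using assms(1) unfolding quantum_channel_def by (rule conjunct1, elim conjE)
  have "\<Phi> X \<in> carrier_mat p p" using lin X unfolding linear_map_def by (elim conjE) (rule bspec)
  note id = tensor_id_one[of X m \<Phi> p, OF X this]
  have "psd (m * 1) X \<longrightarrow> psd (p * 1) (tensor_id m p 1 \<Phi> X)"
    using cp[unfolded completely_positive_def, THEN spec, of 1] by simp
  then show ?thesis using assms(2) unfolding id by simp
qed

section \<open>A matrix entry determined by a block encoding\<close>

lemma tensor_pow_ket0_carrier: "tensor_pow ket0 a \<in> carrier_mat (2 ^ a) 1"
  by (induction a) (auto simp: kron_def ket0_def)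

lemma tensor_pow_ket0_index:
  "i < 2 ^ a \<Longrightarrow> tensor_pow ket0 a $$ (i, 0) = (if i = 0 then 1 else 0)"
proof (induction a arbitrary: i)
  case (Suc a)
  define q r where "q = i div 2 ^ a" "r = i mod 2 ^ a"
  have i: "i = q * 2 ^ a + r" unfolding q_r_def by (rule div_mult_mod_eq[symmetric])
  have qr: "q < 2" "r < 2 ^ a"
    using Suc.prems by (auto simp: q_r_def less_mult_imp_div_less)
  have "tensor_pow ket0 (Suc a) $$ (i, 0) = ket0 $$ (q, 0) * tensor_pow ket0 a $$ (r, 0)"
    using Suc.prems carrier_matD[OF tensor_pow_ket0_carrier, of a]
    by (simp add: kron_def q_r_def ket0_def)
  also have "\<dots> = (if q = 0 \<and> r = 0 then 1 else 0)"
    using qr Suc.IH by (auto simp: ket0_def)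
  also have "(q = 0 \<and> r = 0) = (i = 0)" by (simp add: i)
  finally show ?case by simp
qed simp

text \<open>Testing the supremum at a standard basis vector shows that the corresponding column has
  norm 0.\<close>

lemma op_norm_le_0_entry:
  assumes "op_norm A \<le> 0" "i < dim_row A" "j < dim_col A"
  shows "A $$ (i, j) = 0"
proof -
  define v :: "complex vec" where "v = unit_vec (dim_col A) j"
  have v: "v \<in> carrier_vec (dim_col A)" "l2_norm v \<le> 1"
    using assms(3) by (auto simp: v_def l2_norm_def)
  then have "ereal (l2_norm (A *\<^sub>v v)) \<le> op_norm A"
    unfolding op_norm_def by (intro SUP_upper) auto
  also note assms(1)
  finally have "Re ((A *\<^sub>v v) \<bullet>c (A *\<^sub>v v)) \<le> 0"
    by (simp add: l2_norm_def)
  moreover have "(A *\<^sub>v v) \<bullet>c (A *\<^sub>v v)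
      = complex_of_real (\<Sum>i<dim_row A. (cmod ((A *\<^sub>v v) $ i))\<^sup>2)"
    unfolding cscalar_prod_self by simp
  ultimately have "(\<Sum>i<dim_row A. (cmod ((A *\<^sub>v v) $ i))\<^sup>2) \<le> 0" by simp
  then have "(\<Sum>i<dim_row A. (cmod ((A *\<^sub>v v) $ i))\<^sup>2) = 0"
    by (intro antisym sum_nonneg) auto
  then have "(A *\<^sub>v v) $ i = 0" using assms(2) by (simp add: sum_nonneg_eq_0_iff)
  moreover have "(A *\<^sub>v v) $ i = A $$ (i, j)"
    using assms by (simp add: v_def)
  ultimately show ?thesis by simp
qed

text \<open>The ancilla is the leading tensor factor, so ancilla state 0 with system state 0 has
  index 0, and the corner of the encoded block is the corner of \<open>U\<close> itself.\<close>

lemma block_encoding_corner: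
  assumes "block_encoding \<alpha> a d 0 U A" "A \<in> carrier_mat d d" "0 < d"
  shows "A $$ (0, 0) = complex_of_real \<alpha> * U $$ (0, 0)"
proof -
  define N where "N = 2 ^ a * d"
  have "N > 0" using assms(3) by (simp add: N_def)
  define K K' where "K = kron (tensor_pow ket0 a) (1\<^sub>m d)"
    "K' = kron (mat_adjoint (tensor_pow ket0 a)) (1\<^sub>m d)"
  note ket = carrier_matD[OF tensor_pow_ket0_carrier, of a]
  have K: "K \<in> carrier_mat N d" "K' \<in> carrier_mat d N"
    by (auto simp: K_K'_def kron_def ket N_def)
  have U: "U \<in> carrier_mat N N"
    using assms(1) by (simp add: block_encoding_def unitary_mat_def N_def)
  have div_mod: "i div d < 2 ^ a" "i div d = 0 \<and> i mod d = 0 \<longleftrightarrow> i = 0" if "i < N" for i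
    using that assms(3) by (auto simp: N_def less_mult_imp_div_less div_eq_0_iff)
  have K0: "K $$ (i, 0) = (if i = 0 then 1 else 0)" "K' $$ (0, i) = (if i = 0 then 1 else 0)"
    if "i < N" for i
    using that assms(3) div_mod[OF that] unfolding N_def
    by (auto simp: K_K'_def kron_def ket tensor_pow_ket0_index)
  have "(K' * U * K) $$ (0, 0) = (\<Sum>j<N. (K' * U) $$ (0, j) * K $$ (j, 0))"
    by (rule mult_mat_index[OF mult_carrier_mat[OF K(2) U] K(1)]) (use assms(3) in auto)
  also have "\<dots> = (\<Sum>j<N. if j = 0 then (K' * U) $$ (0, 0) else 0)"
    by (intro sum.cong) (auto simp: K0)
  also have "\<dots> = (K' * U) $$ (0, 0)" using \<open>N > 0\<close> by simp
  also have "\<dots> = (\<Sum>i<N. K' $$ (0, i) * U $$ (i, 0))"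
    by (rule mult_mat_index[OF K(2) U]) (use assms(3) \<open>N > 0\<close> in auto)
  also have "\<dots> = (\<Sum>i<N. if i = 0 then U $$ (0, 0) else 0)"
    by (intro sum.cong) (auto simp: K0)
  also have "\<dots> = U $$ (0, 0)" using \<open>N > 0\<close> by simp
  finally have corner: "(K' * U * K) $$ (0, 0) = U $$ (0, 0)" .
  define W where "W = K' * U * K"
  have W: "W \<in> carrier_mat d d"
    unfolding W_def by (rule mult_carrier_mat[OF mult_carrier_mat[OF K(2) U] K(1)])
  have "op_norm (A - complex_of_real \<alpha> \<cdot>\<^sub>m W) \<le> 0"
    using assms(1) unfolding block_encoding_def W_def K_K'_def zero_ereal_def by blast
  then have "(A - complex_of_real \<alpha> \<cdot>\<^sub>m W) $$ (0, 0) = 0"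
    using W assms(2,3) by (intro op_norm_le_0_entry) auto
  then show ?thesis
    using W assms(2,3) corner unfolding W_def[symmetric] by simp
qed

section \<open>Overlap of channel outputs with pure states\<close>

lemma unitary_column_norm:
  assumes "unitary_mat n U" "k < n"
  shows "(\<Sum>i<n. (cmod (U $$ (i, k)))\<^sup>2) = 1"
proof -
  have U: "U \<in> carrier_mat n n" and eq: "mat_adjoint U * U = 1\<^sub>m n"
    using assms(1) by (auto simp: unitary_mat_def)
  have "complex_of_real (\<Sum>i<n. (cmod (U $$ (i, k)))\<^sup>2) = (mat_adjoint U * U) $$ (k, k)"
    using U assms(2)
    by (simp add: scalar_prod_def atLeast0LessThan complex_norm_square mult.commute del: of_real_power)
  then have "complex_of_real (\<Sum>i<n. (cmod (U $$ (i, k)))\<^sup>2) = complex_of_real 1"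
    using assms(2) by (simp add: eq)
  then show ?thesis by (simp only: of_real_eq_iff)
qed

text \<open>The input state, the projector onto the first basis vector, written as a diagonal matrix
  so that its product with a diagonal program is diagonal by \<open>kron_diagm\<close>.\<close>

abbreviation corner :: "nat \<Rightarrow> complex mat" where
  "corner n \<equiv> diagm n (\<lambda>i. if i = 0 then 1 else 0)"

lemma trace_norm_corner:
  assumes "0 < n"
  shows "trace_norm (corner n) = 1"
proof -
  have "mat_adjoint (corner n) = corner n"
    by (rule eq_matI) (auto simp: diagm_def)
  moreover have "corner n * corner n = corner n"
  proof (rule eq_matI)
    fix i j assume "i < dim_row (corner n)" "j < dim_col (corner n)"
    then have ij: "i < n" "j < n" by (auto simp: diagm_def)
    have "(corner n * corner n) $$ (i, j) = (\<Sum>k<n. corner n $$ (i, k) * corner n $$ (k, j))"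
      using ij by (simp add: scalar_prod_def atLeast0LessThan diagm_def)
    also have "\<dots> = (\<Sum>k<n. if k = i then corner n $$ (i, j) else 0)"
      using ij by (intro sum.cong) (auto simp: diagm_def)
    finally show "(corner n * corner n) $$ (i, j) = corner n $$ (i, j)" using ij by simp
  qed (auto simp: diagm_def)
  ultimately have "trace_norm (corner n) = Re (mtrace (corner n))"
    by (intro trace_norm_projection[of _ n]) auto
  then show ?thesis using assms by (simp add: mtrace_diagm)
qed

lemma conj_corner_index:
  assumes "U \<in> carrier_mat n n" "i < n" "j < n"
  shows "(U * corner n * mat_adjoint U) $$ (i, j) = U $$ (i, 0) * cnj (U $$ (j, 0))"
proof -
  have 1: "(U * corner n) $$ (i, k) = (if k = 0 then U $$ (i, 0) else 0)" if "k < n" for k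
  proof -
    have "(U * corner n) $$ (i, k) = (\<Sum>l<n. U $$ (i, l) * corner n $$ (l, k))"
      using assms that by (simp add: scalar_prod_def atLeast0LessThan diagm_def)
    also have "\<dots> = (\<Sum>l<n. if l = k then (if k = 0 then U $$ (i, 0) else 0) else 0)"
      using that by (intro sum.cong) (auto simp: diagm_def)
    finally show ?thesis using that by simp
  qed
  have "(U * corner n * mat_adjoint U) $$ (i, j)
      = (\<Sum>k<n. (U * corner n) $$ (i, k) * mat_adjoint U $$ (k, j))"
    using assms by (simp add: scalar_prod_def atLeast0LessThan diagm_def)
  also have "\<dots> = (\<Sum>k<n. if k = 0 then U $$ (i, 0) * cnj (U $$ (j, 0)) else 0)"
    using assms 1 by (intro sum.cong) auto
  finally show ?thesis using assms by simp
qed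

text \<open>The ideal output is the projector onto the first column u of \<open>U\<close>, whose
  form at u is 1; the form of the difference at u is bounded by its Frobenius norm and hence by its
  trace norm.\<close>

lemma fidelity_ge:
  assumes U: "unitary_mat N U" and N: "0 < N" and E: "E \<in> carrier_mat N N"
    and close: "trace_norm (E - U * corner N * mat_adjoint U) \<le> \<epsilon>"
  shows "1 - \<epsilon> \<le> qform N E (\<lambda>i. U $$ (i, 0))"
proof -
  define u where "u = (\<lambda>i. U $$ (i, 0))"
  define P where "P = U * corner N * mat_adjoint U"
  have cU: "U \<in> carrier_mat N N" using U by (simp add: unitary_mat_def)
  then have P: "P \<in> carrier_mat N N" unfolding P_def
    by (intro mult_carrier_mat[OF mult_carrier_mat[OF cU diagm_carrier] mat_adjoint_carrier[OF cU]])
  have u: "(\<Sum>i<N. (cmod (u i))\<^sup>2) = 1"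
    unfolding u_def by (rule unitary_column_norm[OF U N])
  have "sform N P u u = (\<Sum>i<N. \<Sum>j<N. (u i * cnj (u i)) * (u j * cnj (u j)))"
    unfolding sform_def P_def
    by (intro sum.cong refl) (simp add: conj_corner_index[OF cU] u_def del: index_mult_mat)
  also have "\<dots> = (\<Sum>i<N. u i * cnj (u i)) * (\<Sum>j<N. u j * cnj (u j))"
    by (simp add: sum_product)
  also have "(\<Sum>i<N. u i * cnj (u i)) = complex_of_real (\<Sum>i<N. (cmod (u i))\<^sup>2)"
    by (simp add: complex_norm_square del: of_real_power)
  finally have "sform N P u u = 1" using u by simp
  have "cmod (sform N (E - P) u u) \<le> trace_norm (E - P)"
    using cmod_sform_le[OF u] frobenius_le_trace_norm[of "E - P" N] E P
    by (meson minus_carrier_mat order_trans)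
  then have "cmod (sform N (E - P) u u) \<le> \<epsilon>" using close by (simp add: P_def)
  then have "\<bar>Re (sform N (E - P) u u)\<bar> \<le> \<epsilon>"
    using abs_Re_le_cmod order_trans by blast
  then show ?thesis
    using \<open>sform N P u u = 1\<close> by (simp add: sform_mat_add[OF E P] u_def)
qed

text \<open>A program below \<open>\<rho>\<^sup>\<otimes>\<^sup>n\<close> inherits the closeness to the pure state \<open>u\<close>: the output on the
  remaining part is positive, so that its overlap with \<open>u\<close> is at most its trace.\<close>
lemma dominated_program_output:
  assumes ch: "quantum_channel (N * d ^ n) N \<Lambda>" and U: "unitary_mat N U" and N: "0 < N"
    and f: "\<And>i. 0 \<le> f i" "(\<Sum>i<d. f i) = 1"
    and g: "\<And>i. 0 \<le> g i" "\<And>i. g i \<le> prod_weight d f n i"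
    and diamond: "diamond_norm N N
      (\<lambda>X. \<Lambda> (kron X (tensor_pow (diagm d f) n)) - U * X * mat_adjoint U) \<le> ereal \<epsilon>"
  defines "E \<equiv> \<Lambda> (kron (corner N) (diagm (d ^ n) g))"
  shows "psd N E" "Re (mtrace E) = (\<Sum>i<d ^ n. g i)"
    "Re (mtrace E) - \<epsilon> \<le> qform N E (\<lambda>i. U $$ (i, 0))"
proof -
  define u where "u = (\<lambda>i. U $$ (i, 0))"
  define c where "c = (\<lambda>i::nat. if i = 0 then 1 else (0::real))"
  define w where "w = prod_weight d f n"
  define M where "M = N * d ^ n"
  \<comment> \<open>The channel output as a function of the program's diagonal weights. It is
    additive, and nonnegative weights yield a positive output whose trace is their sum.\<close>
  define L where "L = (\<lambda>h. \<Lambda> (diagm M (\<lambda>i. c (i div d ^ n) * h (i mod d ^ n))))"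
  have kr: "\<Lambda> (kron (corner N) (diagm (d ^ n) h)) = L h" for h
    by (simp add: L_def kron_diagm c_def M_def)
  have psdL: "psd N (L h)" if "\<And>i. 0 \<le> h i" for h
    unfolding L_def M_def
    by (intro quantum_channel_psd[OF ch] psd_diagm mult_nonneg_nonneg that) (simp add: c_def)
  have trL: "mtrace (L h) = complex_of_real (\<Sum>i<d ^ n. h i)" for h
  proof -
    have "mtrace (L h) = mtrace (diagm M (\<lambda>i. c (i div d ^ n) * h (i mod d ^ n)))"
      using ch unfolding L_def quantum_channel_def trace_preserving_def M_def by simp
    also have "\<dots> = complex_of_real ((\<Sum>i<N. c i) * (\<Sum>i<d ^ n. h i))"
      by (simp only: mtrace_diagm M_def sum_div_mod)
    also have "(\<Sum>i<N. c i) = 1" using N by (simp add: c_def)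
    finally show ?thesis by simp
  qed
  have add: "L (\<lambda>i. h i + k i) = L h + L k" for h k
  proof -
    have "diagm M (\<lambda>i. c (i div d ^ n) * (h (i mod d ^ n) + k (i mod d ^ n)))
      = diagm M (\<lambda>i. c (i div d ^ n) * h (i mod d ^ n)) + diagm M (\<lambda>i. c (i div d ^ n) * k (i mod d ^ n))"
      by (simp add: distrib_left diagm_add)
    then show ?thesis
      using ch unfolding L_def quantum_channel_def linear_map_def M_def by simp
  qed
  have EL: "E = L g" by (simp add: E_def kr)
  show "psd N E" unfolding EL using g(1) by (rule psdL)
  show tr: "Re (mtrace E) = (\<Sum>i<d ^ n. g i)" by (simp add: EL trL)
  have carr: "L g \<in> carrier_mat N N" "L (\<lambda>i. w i - g i) \<in> carrier_mat N N" "L w \<in> carrier_mat N N"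
    using psdL[of g] psdL[of "\<lambda>i. w i - g i"] psdL[of w] g prod_weight_nonneg[of f d n, OF f(1)]
    by (auto simp: psd_def w_def)
  have "trace_norm (\<Lambda> (kron (corner N) (tensor_pow (diagm d f) n)) - U * corner N * mat_adjoint U) \<le> \<epsilon>"
    using U carr(3) trace_norm_corner[OF N] diamond
    by (intro trace_norm_le_diamond_norm[of "corner N" N
          "\<lambda>X. \<Lambda> (kron X (tensor_pow (diagm d f) n)) - U * X * mat_adjoint U" N])
      (auto simp: unitary_mat_def tensor_pow_diagm kr w_def)
  then have "1 - \<epsilon> \<le> qform N (L w) u"
    unfolding u_def using fidelity_ge[OF U N carr(3)] by (simp add: tensor_pow_diagm kr w_def)
  also have "L w = L g + L (\<lambda>i. w i - g i)" by (simp flip: add)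
  also have "qform N \<dots> u = qform N (L g) u + qform N (L (\<lambda>i. w i - g i)) u"
    using sform_mat_add(1)[OF carr(1,2)] by simp
  also have "qform N (L (\<lambda>i. w i - g i)) u \<le> Re (mtrace (L (\<lambda>i. w i - g i)))"
    unfolding u_def using g(2)
    by (intro qform_le_trace psdL unitary_column_norm[OF U N]) (simp add: w_def)
  also have "\<dots> = 1 - (\<Sum>i<d ^ n. g i)"
    unfolding trL w_def sum_subtractf sum_prod_weight f(2) by simp
  finally show "Re (mtrace E) - \<epsilon> \<le> qform N E (\<lambda>i. U $$ (i, 0))"
    using tr unfolding EL u_def[symmetric] by simp
qed

section \<open>The bound on the number of copies\<close>

lemma density_operator_diagm:
  assumes "\<And>i. 0 \<le> f i" "(\<Sum>i<d. f i) = 1"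
  shows "density_operator d (diagm d f)"
  using assms by (simp add: density_operator_def psd_diagm mtrace_diagm)

text \<open>A program lying below the copies of both states gives one output that is nearly aligned
  with two pure states, while the encoding keeps their first components apart.\<close>

lemma copies_lower_bound:
  assumes \<alpha>: "1 \<le> \<alpha>" and d: "2 \<le> d"
    and ch: "quantum_channel (2 ^ a * d * d ^ n) (2 ^ a * d) \<Lambda>"
    and approx: "\<And>\<rho>. density_operator d \<rho> \<Longrightarrow> \<exists>U. block_encoding \<alpha> a d 0 U \<rho> \<and>
      diamond_norm (2 ^ a * d) (2 ^ a * d)
        (\<lambda>X. \<Lambda> (kron X (tensor_pow \<rho> n)) - U * X * mat_adjoint U) \<le> ereal \<epsilon>"
  shows "1 \<le> 384 * \<alpha> ^ 4 * \<epsilon> * (real n + 1)"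
proof -
  define N where "N = 2 ^ a * d"
  have N: "0 < N" using d by (simp add: N_def)
  \<comment> \<open>The largest order of \<delta> for which the overlap of the \<open>n\<close>-copy
    states stays bounded below; \<open>n + 1\<close> avoids division by zero at n = 0 and gives
    \<delta> \<le> 1.\<close>
  define \<delta> where "\<delta> = 1 / (2 * sqrt (real n + 1))"
  have \<delta>2: "\<delta>\<^sup>2 = 1 / (4 * (real n + 1))"
    by (simp add: \<delta>_def power_divide power_mult_distrib)
  have "1 \<le> sqrt (real n + 1)" by simp
  then have "1 \<le> 2 * sqrt (real n + 1)" by linarith
  then have \<delta>: "0 < \<delta>" "\<delta> \<le> 1" unfolding \<delta>_def by simp_all
  have \<delta>n: "4 * real n * \<delta>\<^sup>2 \<le> 1" by (simp add: \<delta>2 field_simps)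
  define f f' where "f = bern ((1 + \<delta>) / 2)" "f' = bern ((1 - \<delta>) / 2)"
  have f: "0 \<le> f i" "0 \<le> f' i" "(\<Sum>i<d. f i) = 1" "(\<Sum>i<d. f' i) = 1" for i
    using \<delta> sum_bern[OF d] by (auto simp: f_f'_def bern_def field_simps)
  obtain U where U: "block_encoding \<alpha> a d 0 U (diagm d f)" "diamond_norm N N
      (\<lambda>X. \<Lambda> (kron X (tensor_pow (diagm d f) n)) - U * X * mat_adjoint U) \<le> ereal \<epsilon>"
    using approx[OF density_operator_diagm] f unfolding N_def by blast
  obtain U' where U': "block_encoding \<alpha> a d 0 U' (diagm d f')" "diamond_norm N N
      (\<lambda>X. \<Lambda> (kron X (tensor_pow (diagm d f') n)) - U' * X * mat_adjoint U') \<le> ereal \<epsilon>"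
    using approx[OF density_operator_diagm] f unfolding N_def by blast
  have un: "unitary_mat N U" "unitary_mat N U'"
    using U U' by (auto simp: block_encoding_def N_def)
  \<comment> \<open>The pointwise minimum is the largest diagonal program below both tensor
    powers.\<close>
  define g where "g = (\<lambda>i. min (prod_weight d f n i) (prod_weight d f' n i))"
  have g: "0 \<le> g i" "g i \<le> prod_weight d f n i" "g i \<le> prod_weight d f' n i" for i
    using prod_weight_nonneg f by (auto simp: g_def)
  define E where "E = \<Lambda> (kron (corner N) (diagm (d ^ n) g))"
  note out = dominated_program_output[OF ch[folded N_def] un(1) N f(1,3) g(1,2) U(2), folded E_def]
  note out' = dominated_program_output[OF ch[folded N_def] un(2) N f(2,4) g(1,3) U'(2), folded E_def]
  have "complex_of_real (f 0) = of_real \<alpha> * U $$ (0, 0)" "complex_of_real (f' 0) = of_real \<alpha> * U' $$ (0, 0)"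
    using block_encoding_corner[OF U(1)] block_encoding_corner[OF U'(1)] d by (auto simp: diagm_def)
  then have "U $$ (0, 0) = of_real (f 0 / \<alpha>)" "U' $$ (0, 0) = of_real (f' 0 / \<alpha>)"
    using \<alpha> by (auto simp: field_simps)
  then have "(cmod (U $$ (0, 0)))\<^sup>2 = (f 0 / \<alpha>)\<^sup>2" "(cmod (U' $$ (0, 0)))\<^sup>2 = (f' 0 / \<alpha>)\<^sup>2"
    by (simp_all only: norm_of_real power2_abs)
  \<comment> \<open>The squares of (1 + \<delta>) / 2 and (1 - \<delta>) / 2 differ by exactly
    \<delta>.\<close>
  then have diff: "\<delta> / \<alpha>\<^sup>2 = (cmod (U $$ (0, 0)))\<^sup>2 - (cmod (U' $$ (0, 0)))\<^sup>2"
    by (simp add: f_f'_def bern_def power_divide diff_divide_distrib[symmetric])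
      (simp add: power2_eq_square field_simps)
  have "0 < \<delta> / \<alpha>\<^sup>2" using \<delta> \<alpha> by simp
  then have "Re (mtrace E) * (\<delta> / \<alpha>\<^sup>2)\<^sup>2 \<le> 24 * \<epsilon>"
    by (intro trace_mult_sq_diff_le[OF out(1) N unitary_column_norm[OF un(1) N] out(3)
        unitary_column_norm[OF un(2) N] out'(3) diff])
  moreover have "1 / 4 \<le> Re (mtrace E)"
    unfolding out(2) g_def f_f'_def using overlap_bern[OF d _ _ \<delta>n] \<delta> by simp
  ultimately have "1 / 4 * (\<delta> / \<alpha>\<^sup>2)\<^sup>2 \<le> 24 * \<epsilon>"
    by (meson mult_right_mono order_trans zero_le_power2)
  moreover have "(\<delta> / \<alpha>\<^sup>2)\<^sup>2 = 1 / (4 * (real n + 1) * \<alpha> ^ 4)"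
    by (simp add: power_divide \<delta>2 flip: power_mult)
  \<comment> \<open>One factor 4 comes from the trace of \<open>E\<close> and one from
    \<open>\<delta>\<^sup>2\<close>; with the 24 this makes 384 = 24 * 16.\<close>
  moreover have "1 / (16 * (real n + 1) * \<alpha> ^ 4) = 1 / 4 * (1 / (4 * (real n + 1) * \<alpha> ^ 4))"
    by (simp add: mult.assoc)
  ultimately have "1 / (16 * (real n + 1) * \<alpha> ^ 4) \<le> 24 * \<epsilon>" by (simp only:)
  moreover have "0 < 16 * (real n + 1) * \<alpha> ^ 4" using \<alpha> by (intro mult_pos_pos) auto
  ultimately have "1 \<le> 24 * \<epsilon> * (16 * (real n + 1) * \<alpha> ^ 4)"
    by (simp only: pos_divide_le_eq)
  then show ?thesis by (simp add: algebra_simps)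
qed

theorem theorem3:
  fixes \<alpha>0 :: real
  assumes "1 \<le> \<alpha>0"
  shows "\<exists>c \<epsilon>0 :: real. 0 < c \<and> 0 < \<epsilon>0 \<and> \<epsilon>0 < 1 / 4 \<and>
    (\<forall>(\<alpha> :: real) (a :: nat) (d :: nat) (\<epsilon> :: real) (n :: nat).
       1 \<le> \<alpha> \<longrightarrow> \<alpha> \<le> \<alpha>0 \<longrightarrow> 2 < a \<longrightarrow> 2 \<le> d \<longrightarrow> 0 < \<epsilon> \<longrightarrow> \<epsilon> < \<epsilon>0 \<longrightarrow>
       (\<exists>\<Lambda> \<Lambda>'.
          quantum_channel (2 ^ a * d * d ^ n) (2 ^ a * d) \<Lambda> \<and>
          quantum_channel (2 ^ a * d * d ^ n) (2 ^ a * d) \<Lambda>' \<and>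
          (\<forall>\<rho>. density_operator d \<rho> \<longrightarrow>
             (\<exists>U. block_encoding \<alpha> a d 0 U \<rho> \<and>
                diamond_norm (2 ^ a * d) (2 ^ a * d)
                  (\<lambda>X. \<Lambda> (kron X (tensor_pow \<rho> n)) - U * X * mat_adjoint U) \<le> ereal \<epsilon> \<and>
                diamond_norm (2 ^ a * d) (2 ^ a * d)
                  (\<lambda>X. \<Lambda>' (kron X (tensor_pow \<rho> n)) - mat_adjoint U * X * U) \<le> ereal \<epsilon>))) \<longrightarrow>
       c / \<epsilon> \<le> real n)"
proof -
  \<comment> \<open>Twice 384: the spare factor 2 pays for replacing \<open>n + 1\<close> by
    \<open>n\<close>. The same number serves as the threshold for \<epsilon>.\<close>
  define c where "c = 1 / (768 * \<alpha>0 ^ 4)"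
  have "1 \<le> \<alpha>0 ^ 4" using assms by (rule one_le_power)
  then have c: "0 < c" "c < 1 / 4" and c': "768 * \<alpha>0 ^ 4 = 1 / c"
    by (auto simp: c_def divide_less_eq)
  show ?thesis
  proof (intro exI[of _ c] conjI c allI impI, elim exE conjE)
    fix \<alpha> :: real and a d n :: nat and \<epsilon> :: real and \<Lambda> \<Lambda>' :: "complex mat \<Rightarrow> complex mat"
    assume \<alpha>: "1 \<le> \<alpha>" "\<alpha> \<le> \<alpha>0" and d: "2 \<le> d" and \<epsilon>: "0 < \<epsilon>" "\<epsilon> < c"
      and ch: "quantum_channel (2 ^ a * d * d ^ n) (2 ^ a * d) \<Lambda>"
      and approx: "\<forall>\<rho>. density_operator d \<rho> \<longrightarrow>
             (\<exists>U. block_encoding \<alpha> a d 0 U \<rho> \<and>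
                diamond_norm (2 ^ a * d) (2 ^ a * d)
                  (\<lambda>X. \<Lambda> (kron X (tensor_pow \<rho> n)) - U * X * mat_adjoint U) \<le> ereal \<epsilon> \<and>
                diamond_norm (2 ^ a * d) (2 ^ a * d)
                  (\<lambda>X. \<Lambda>' (kron X (tensor_pow \<rho> n)) - mat_adjoint U * X * U) \<le> ereal \<epsilon>)"
    have "1 \<le> 384 * \<alpha> ^ 4 * \<epsilon> * (real n + 1)"
      by (rule copies_lower_bound[OF \<alpha>(1) d ch]) (use approx in blast)
    also have "\<dots> \<le> 384 * \<alpha>0 ^ 4 * \<epsilon> * (real n + 1)"
      using \<alpha> \<epsilon> by (intro mult_right_mono mult_left_mono power_mono) auto
    also have "\<dots> = \<epsilon> * (real n + 1) / (2 * c)"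
      using c' c by (simp add: field_simps)
    finally have "2 * c \<le> \<epsilon> * (real n + 1)" using c by (simp add: field_simps)
    \<comment> \<open>As \<epsilon> < c, the summand \<epsilon> coming from \<open>n + 1\<close>
      uses up at most one of the two copies of \<open>c\<close>.\<close>
    then have "c \<le> \<epsilon> * real n" using \<epsilon> by (simp add: algebra_simps)
    then show "c / \<epsilon> \<le> real n" using \<epsilon> by (simp add: field_simps)
  qed
qed

end
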